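(* Let $G$ be a group. Suppose that there exist two subsets $A \subset B \subset G$ satisfying the following conditions. (1) $G$ is boundedly generated by $A$, i.e., there exists some $N \geq 0$ such that every element of $G$ is the product of at most $N$ elements of $A$. (2) For every $a,b \in B$, there exist $g,h \in G$ such that $$[gag^{-1},a]=[gag^{-1},hgag^{-1}h^{-1}]=[hgag^{-1}h^{-1},b]=1.$$ (3) For every $a,b \in G$, there exist an integer $r$ and elements $h, h_1, \ldots, h_r \in B$ such that the following holds: for every $k \in A$, there exists some $f \in \langle h_1 \rangle \cdots \langle h_r \rangle$ such that the elements $fkf^{-1}h$, $fkf^{-1}ha$ and $fkf^{-1}hb$ all belong to $B$. Then any isometric action of $G$ on a Gromov-hyperbolic space fixes a point at infinity, or stabilises a pair of points at infinity, or has bounded orbits.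
   Context: Here $[x,y]$ denotes the commutator of $x$ and $y$, and $\langle h_1\rangle\cdots\langle h_r\rangle$ is the set of products $h_1^{n_1}\cdots h_r^{n_r}$ with $n_i\in\mathbb{Z}$. A metric space $X$ is $\delta$-hyperbolic ($\delta\ge 0$) if $(x,z)_w \geq \min((x,y)_w,(y,z)_w)-\delta$ for all $x,y,z,w\in X$, where $(x,y)_z=\frac12(d(z,x)+d(z,y)-d(x,y))$ is the Gromov product; it is (Gromov-)hyperbolic if it is $\delta$-hyperbolic for some $\delta\ge0$. The points at infinity of $X$ are the points of its Gromov boundary: equivalence classes of sequences $(x_i)$ with $(x_i,x_j)_{x_0}\to+\infty$ as $i,j\to+\infty$ (for a basepoint $x_0$), two sequences $(y_i),(z_i)$ being equivalent if $(y_i,z_i)_{x_0}\to+\infty$. Isometries of $X$ act on this boundary. *)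

theory Defs
  imports "HOL-Analysis.Elementary_Metric_Spaces" "HOL-Algebra.Group_Action"
begin

subsection \<open>Groups\<close>

definition list_mult :: "('a, 'c) monoid_scheme \<Rightarrow> 'a list \<Rightarrow> 'a" where
  "list_mult G xs = foldr (\<otimes>\<^bsub>G\<^esub>) xs \<one>\<^bsub>G\<^esub>"

text \<open>Only elements of \<open>A\<close> itself are allowed as factors, not their inverses.\<close>

definition boundedly_generated_by :: "('a, 'c) monoid_scheme \<Rightarrow> 'a set \<Rightarrow> bool" where
  "boundedly_generated_by G A \<longleftrightarrow>
     (\<exists>N::nat. \<forall>g\<in>carrier G. \<exists>xs. length xs \<le> N \<and> set xs \<subseteq> A \<and> g = list_mult G xs)"

definition commutator :: "('a, 'c) monoid_scheme \<Rightarrow> 'a \<Rightarrow> 'a \<Rightarrow> 'a" where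
  "commutator G x y = x \<otimes>\<^bsub>G\<^esub> y \<otimes>\<^bsub>G\<^esub> inv\<^bsub>G\<^esub> x \<otimes>\<^bsub>G\<^esub> inv\<^bsub>G\<^esub> y"

text \<open>For \<open>hs = [h\<^sub>1, \<dots>, h\<^sub>r]\<close> this is
  \<open>\<langle>h\<^sub>1\<rangle> \<cdots> \<langle>h\<^sub>r\<rangle>\<close>; it is \<open>{\<one>}\<close> for the empty list.\<close>

definition cyclic_product :: "('a, 'c) monoid_scheme \<Rightarrow> 'a list \<Rightarrow> 'a set" where
  "cyclic_product G hs =
     {list_mult G (map2 (\<lambda>h n. h [^]\<^bsub>G\<^esub> n) hs ns) | ns :: int list. length ns = length hs}"


subsection \<open>Hyperbolic spaces and their Gromov boundary\<close>

text \<open>The basepoint comes first: \<open>Gromov_product w x y\<close> is \<open>(x,y)\<^sub>w\<close>.\<close>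

definition Gromov_product :: "'x::metric_space \<Rightarrow> 'x \<Rightarrow> 'x \<Rightarrow> real" where
  "Gromov_product w x y = (dist w x + dist w y - dist x y) / 2"

definition delta_hyperbolic :: "real \<Rightarrow> 'x::metric_space set \<Rightarrow> bool" where
  "delta_hyperbolic \<delta> X \<longleftrightarrow>
     (\<forall>x\<in>X. \<forall>y\<in>X. \<forall>z\<in>X. \<forall>w\<in>X.
        Gromov_product w x z \<ge> min (Gromov_product w x y) (Gromov_product w y z) - \<delta>)"

definition Gromov_hyperbolic :: "'x::metric_space set \<Rightarrow> bool" where
  "Gromov_hyperbolic X \<longleftrightarrow> (\<exists>\<delta>\<ge>0. delta_hyperbolic \<delta> X)"

definition Gromov_sequences :: "'x::metric_space \<Rightarrow> (nat \<Rightarrow> 'x) set" where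
  "Gromov_sequences x0 =
     {s. filterlim (\<lambda>(i, j). Gromov_product x0 (s i) (s j)) at_top (sequentially \<times>\<^sub>F sequentially)}"

definition Gromov_equiv :: "'x::metric_space \<Rightarrow> ((nat \<Rightarrow> 'x) \<times> (nat \<Rightarrow> 'x)) set" where
  "Gromov_equiv x0 =
     {(s, t). s \<in> Gromov_sequences x0 \<and> t \<in> Gromov_sequences x0 \<and>
              filterlim (\<lambda>i. Gromov_product x0 (s i) (t i)) at_top sequentially}"

definition Gromov_boundary :: "'x::metric_space \<Rightarrow> (nat \<Rightarrow> 'x) set set" where
  "Gromov_boundary x0 = Gromov_sequences x0 // Gromov_equiv x0"

text \<open>The action on the boundary, \<open>[(x\<^sub>i)] \<mapsto> [(f x\<^sub>i)]\<close>: for a bijective isometry \<open>f\<close>, the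
  image of an equivalence class is again a whole equivalence class
  (\<open>boundary_map_class\<close> below).\<close>

definition boundary_map :: "('x \<Rightarrow> 'x) \<Rightarrow> (nat \<Rightarrow> 'x) set \<Rightarrow> (nat \<Rightarrow> 'x) set" where
  "boundary_map f \<xi> = (\<lambda>s. f \<circ> s) ` \<xi>"

definition isometric_action ::
    "('a, 'c) monoid_scheme \<Rightarrow> ('a \<Rightarrow> 'x::metric_space \<Rightarrow> 'x) \<Rightarrow> bool" where
  "isometric_action G \<phi> \<longleftrightarrow>
     group_action G UNIV \<phi> \<and> (\<forall>g\<in>carrier G. \<forall>x y. dist (\<phi> g x) (\<phi> g y) = dist x y)"


subsection \<open>Well-definedness\<close>

lemma Gromov_product_basepoint: "\<bar>Gromov_product v x y - Gromov_product w x y\<bar> \<le> dist v w"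
  unfolding Gromov_product_def by (simp add: abs_le_iff) metric

lemma filterlim_Gromov_product_basepoint:
  assumes "filterlim (\<lambda>i. Gromov_product v (a i) (b i)) at_top F"
  shows "filterlim (\<lambda>i. Gromov_product w (a i) (b i)) at_top F"
proof (rule filterlim_at_top_mono)
  show "filterlim (\<lambda>i. - dist v w + Gromov_product v (a i) (b i)) at_top F"
    by (rule filterlim_tendsto_add_at_top[OF tendsto_const assms])
  show "\<forall>\<^sub>F i in F. - dist v w + Gromov_product v (a i) (b i) \<le> Gromov_product w (a i) (b i)"
    using Gromov_product_basepoint[of v _ _ w]
    by (intro always_eventually allI) (smt (verit))
qed

lemma Gromov_sequences_basepoint: "Gromov_sequences v = Gromov_sequences w"
  unfolding Gromov_sequences_def case_prod_unfold
  by (intro Collect_cong iffI; erule filterlim_Gromov_product_basepoint)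

lemma Gromov_equiv_basepoint: "Gromov_equiv v = Gromov_equiv w"
  unfolding Gromov_equiv_def Gromov_sequences_basepoint[of v w]
  by (auto intro: filterlim_Gromov_product_basepoint)

lemma Gromov_boundary_basepoint: "Gromov_boundary v = Gromov_boundary w"
  unfolding Gromov_boundary_def using Gromov_sequences_basepoint Gromov_equiv_basepoint by metis

lemma equiv_Gromov_equiv:
  fixes x0 :: "'x::metric_space"
  assumes "Gromov_hyperbolic (UNIV :: 'x set)"
  shows "equiv (Gromov_sequences x0) (Gromov_equiv x0)"
proof -
  obtain \<delta> where \<delta>: "\<And>x y z w :: 'x.
      Gromov_product w x z \<ge> min (Gromov_product w x y) (Gromov_product w y z) - \<delta>"
    using assms unfolding Gromov_hyperbolic_def delta_hyperbolic_def by blast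
  have diag: "filterlim (\<lambda>i. (i, i)) (sequentially \<times>\<^sub>F sequentially) sequentially"
    by (intro filterlim_Pair filterlim_ident)
  have refl: "(s, s) \<in> Gromov_equiv x0" if "s \<in> Gromov_sequences x0" for s
    using that filterlim_compose[OF _ diag, of "\<lambda>(i, j). Gromov_product x0 (s i) (s j)" at_top]
    by (auto simp: Gromov_sequences_def Gromov_equiv_def)
  have sym: "sym (Gromov_equiv x0)"
    by (auto simp: sym_def Gromov_equiv_def Gromov_product_def dist_commute add.commute)
  have trans: "filterlim (\<lambda>i. Gromov_product x0 (s i) (u i)) at_top sequentially"
    if "filterlim (\<lambda>i. Gromov_product x0 (s i) (t i)) at_top sequentially"
       "filterlim (\<lambda>i. Gromov_product x0 (t i) (u i)) at_top sequentially" for s t u :: "nat \<Rightarrow> 'x"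
    unfolding filterlim_at_top
  proof
    fix Z :: real
    have "\<forall>\<^sub>F i in sequentially. Z + \<delta> \<le> Gromov_product x0 (s i) (t i)"
         "\<forall>\<^sub>F i in sequentially. Z + \<delta> \<le> Gromov_product x0 (t i) (u i)"
      using that unfolding filterlim_at_top by blast+
    then show "\<forall>\<^sub>F i in sequentially. Z \<le> Gromov_product x0 (s i) (u i)"
    proof eventually_elim
      case (elim i)
      then show ?case using \<delta>[where x="s i" and y="t i" and z="u i" and w=x0] by linarith
    qed
  qed
  show ?thesis
    unfolding equiv_def refl_on_def
    using refl sym trans by (auto simp: trans_def Gromov_equiv_def)
qed

lemma isometry_Gromov_equiv:
  assumes "\<And>x y. dist (f x) (f y) = dist x (y :: 'x::metric_space)"
  shows "f \<circ> s \<in> Gromov_sequences x0 \<longleftrightarrow> s \<in> Gromov_sequences x0"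
    and "(f \<circ> s, f \<circ> t) \<in> Gromov_equiv x0 \<longleftrightarrow> (s, t) \<in> Gromov_equiv x0"
proof -
  have *: "Gromov_product (f x0) (f x) (f y) = Gromov_product x0 x y" for x y
    by (simp add: Gromov_product_def assms)
  show seq: "f \<circ> s \<in> Gromov_sequences x0 \<longleftrightarrow> s \<in> Gromov_sequences x0" for s
  proof -
    have "f \<circ> s \<in> Gromov_sequences (f x0) \<longleftrightarrow> s \<in> Gromov_sequences x0"
      using * by (simp add: Gromov_sequences_def)
    then show ?thesis using Gromov_sequences_basepoint[of x0 "f x0"] by simp
  qed
  show "(f \<circ> s, f \<circ> t) \<in> Gromov_equiv x0 \<longleftrightarrow> (s, t) \<in> Gromov_equiv x0"
  proof -
    have "(f \<circ> s, f \<circ> t) \<in> Gromov_equiv (f x0) \<longleftrightarrow> (s, t) \<in> Gromov_equiv x0"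
      using * seq Gromov_sequences_basepoint[of "f x0" x0] by (simp add: Gromov_equiv_def)
    then show ?thesis using Gromov_equiv_basepoint[of x0 "f x0"] by simp
  qed
qed

lemma boundary_map_class:
  assumes "\<And>x y. dist (f x) (f y) = dist x (y :: 'x::metric_space)" and "surj f"
  shows "boundary_map f (Gromov_equiv x0 `` {s}) = Gromov_equiv x0 `` {f \<circ> s}"
proof (intro equalityI subsetI)
  fix t assume "t \<in> Gromov_equiv x0 `` {f \<circ> s}"
  moreover have "t = f \<circ> (inv_into UNIV f \<circ> t)"
    using assms(2) by (simp add: fun_eq_iff surj_f_inv_f)
  ultimately show "t \<in> boundary_map f (Gromov_equiv x0 `` {s})"
    using isometry_Gromov_equiv(2)[OF assms(1), where s = s and t = "inv_into UNIV f \<circ> t"]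
    unfolding boundary_map_def by auto
qed (auto simp: boundary_map_def isometry_Gromov_equiv(2)[OF assms(1)])

end

theory Submission
  imports Defs
begin

text \<open>
  Everything is read off from the length \<open>len g\<close>, the displacement of the basepoint by \<open>g\<close>. In fact the
  proof produces a fixed point at infinity or bounded orbits.

  If some \<open>a \<in> B\<close> has unbounded powers, these accumulate at a pair of points at infinity, distinct if \<open>a\<close>
  is loxodromic and equal if it is parabolic. Commuting conjugates have the same pair
  (\<open>commuting_endpoint_pairs\<close>), so the commutation hypothesis carries the pair of \<open>a\<close> through two
  conjugates to one that commutes with a given \<open>b \<in> B\<close>. Hence every \<open>b \<in> B\<close> fixes it
  (\<open>commuting_chain_fixes_endpoint\<close>), and \<open>B\<close> contains a generating set.

  Now let all elements of \<open>B\<close> be elliptic. If \<open>A\<close> moves the basepoint a bounded distance, bounded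
  generation makes all orbits bounded. Otherwise let \<open>a\<close> and \<open>b\<close> be any elements of \<open>G\<close>. The set
  \<open>\<langle>h\<^sub>1\<rangle> \<cdots> \<langle>h\<^sub>r\<rangle>\<close> moves the basepoint a bounded distance, so the last hypothesis, applied to long
  \<open>k \<in> A\<close>, yields arbitrarily long \<open>u\<close> with \<open>u\<close>, \<open>u a\<close> and \<open>u b\<close> elliptic. An elliptic element turns back at the
  midpoint of its displacement: its inverse starts in the same direction as itself. Since \<open>u\<close> and
  \<open>u a\<close> are close, so are \<open>u\<^sup>-\<^sup>1\<close> and \<open>a\<^sup>-\<^sup>1 u\<^sup>-\<^sup>1\<close> as seen from the basepoint, and similarly for \<open>b\<close>
  (\<open>gp_inv_mult_lower\<close>). Thus any two elements of \<open>G\<close> almost fix a common direction at infinity. If \<open>G\<close>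
  contains a loxodromic \<open>a\<close> (in the guise of \<open>escaping\<close>), it follows that each element of \<open>G\<close> fixes
  one of the two ends of \<open>a\<close>, and since a group is not the union of two proper subgroups, one end is fixed by all of \<open>G\<close>
  (\<open>fixes_end_of_escaping\<close>, \<open>fixes_one_of_two_ends\<close>). If \<open>G\<close> contains no loxodromic element, all its long
  elements point in the same direction (\<open>gp_lower_if_not_escaping\<close>), and this direction is fixed.
\<close>

section \<open>Sequences in a hyperbolic space\<close>

lemma Gromov_product_commute: "Gromov_product w x y = Gromov_product w y x"
  by (simp add: Gromov_product_def dist_commute)

lemma Gromov_product_le_dist: "Gromov_product w x y \<le> dist w x"
  unfolding Gromov_product_def by metric

lemma Gromov_product_perturb: "Gromov_product w x y \<ge> Gromov_product w x y' - dist y y'"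
proof -
  have "dist w y' \<le> dist w y + dist y y'" "dist x y \<le> dist x y' + dist y y'"
    by metric+
  then show ?thesis unfolding Gromov_product_def by (simp add: field_simps)
qed

lemma Gromov_sequences_iff:
  "s \<in> Gromov_sequences w \<longleftrightarrow> (\<forall>Z. \<exists>I. \<forall>i\<ge>I. \<forall>j\<ge>I. Gromov_product w (s i) (s j) \<ge> Z)"
  unfolding Gromov_sequences_def filterlim_at_top
  by (auto simp: eventually_prod_sequentially) (metis order_trans linear)+

lemma Gromov_equiv_iff:
  "(s, t) \<in> Gromov_equiv w \<longleftrightarrow> s \<in> Gromov_sequences w \<and> t \<in> Gromov_sequences w \<and>
     (\<forall>Z. \<exists>I. \<forall>i\<ge>I. Gromov_product w (s i) (t i) \<ge> Z)"
  unfolding Gromov_equiv_def filterlim_at_top by (auto simp: eventually_sequentially)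

lemma delta_hyperbolicD:
  fixes w x y z :: "'x::metric_space"
  assumes "delta_hyperbolic \<delta> (UNIV :: 'x set)"
  shows "Gromov_product w x z \<ge> min (Gromov_product w x y) (Gromov_product w y z) - \<delta>"
  using assms by (simp add: delta_hyperbolic_def)

lemma Gromov_equiv_if_close:
  assumes s: "s \<in> Gromov_sequences w" and close: "\<And>i. dist (s i) (t i) \<le> C"
  shows "(s, t) \<in> Gromov_equiv w"
proof -
  have *: "Gromov_product w (s i) (t j) \<ge> Gromov_product w (s i) (s j) - C"
          "Gromov_product w (t i) (t j) \<ge> Gromov_product w (s i) (s j) - 2 * C" for i j
    using Gromov_product_perturb[of w "s i" "s j" "t j"] Gromov_product_perturb[of w "t j" "s i" "t i"]
      close[of i] close[of j]
    by (simp_all add: dist_commute Gromov_product_commute)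
  have "\<exists>I. \<forall>i\<ge>I. \<forall>j\<ge>I. Gromov_product w (t i) (t j) \<ge> Z" for Z
  proof -
    obtain I where "\<forall>i\<ge>I. \<forall>j\<ge>I. Gromov_product w (s i) (s j) \<ge> Z + 2 * C"
      using s unfolding Gromov_sequences_iff by blast
    then show ?thesis using *(2) by (meson add_le_imp_le_diff order_trans)
  qed
  moreover have "\<exists>I. \<forall>i\<ge>I. Gromov_product w (s i) (t i) \<ge> Z" for Z
  proof -
    obtain I where "\<forall>i\<ge>I. \<forall>j\<ge>I. Gromov_product w (s i) (s j) \<ge> Z + C"
      using s unfolding Gromov_sequences_iff by blast
    then show ?thesis using *(1) by (meson add_le_imp_le_diff order_trans)
  qed
  ultimately show ?thesis using s unfolding Gromov_equiv_iff Gromov_sequences_iff by blast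
qed

text \<open>Distinct points at infinity stay apart: a large product of two far terms \<open>s k\<close> and \<open>t l\<close> would,
  by two applications of hyperbolicity, force all \<open>(s i, t i)\<close> with \<open>i\<close> large to have a large product.\<close>

lemma not_Gromov_equiv_bounded:
  fixes s t :: "nat \<Rightarrow> 'x::metric_space"
  assumes hyp: "delta_hyperbolic \<delta> (UNIV :: 'x set)"
    and s: "s \<in> Gromov_sequences w" and t: "t \<in> Gromov_sequences w"
    and neq: "(s, t) \<notin> Gromov_equiv w"
  obtains p I where "\<And>k l. k \<ge> I \<Longrightarrow> l \<ge> I \<Longrightarrow> Gromov_product w (s k) (t l) \<le> p"
proof -
  obtain Z where Z: "\<And>I. \<exists>i\<ge>I. Gromov_product w (s i) (t i) < Z"
    using neq s t unfolding Gromov_equiv_iff by (meson not_le)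
  obtain I1 where I1: "\<forall>i\<ge>I1. \<forall>j\<ge>I1. Gromov_product w (s i) (s j) \<ge> Z + 2 * \<bar>\<delta>\<bar>"
    using s unfolding Gromov_sequences_iff by blast
  obtain I2 where I2: "\<forall>i\<ge>I2. \<forall>j\<ge>I2. Gromov_product w (t i) (t j) \<ge> Z + 2 * \<bar>\<delta>\<bar>"
    using t unfolding Gromov_sequences_iff by blast
  have "Gromov_product w (s k) (t l) \<le> Z + 2 * \<bar>\<delta>\<bar>" if "k \<ge> max I1 I2" "l \<ge> max I1 I2" for k l
  proof (rule ccontr)
    assume far: "\<not> ?thesis"
    obtain i where i: "i \<ge> max I1 I2" "Gromov_product w (s i) (t i) < Z" using Z by blast
    show False
      using far i I1[rule_format, of i k] I2[rule_format, of l i] that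
        delta_hyperbolicD[OF hyp, of w "s i" "s k" "t i"] delta_hyperbolicD[OF hyp, of w "s k" "t l" "t i"]
      by auto
  qed
  then show ?thesis by (rule that)
qed


section \<open>Group elements seen from a basepoint\<close>

locale hyperbolic_isometric_action = group G for G :: "('a, 'c) monoid_scheme" (structure) +
  fixes \<phi> :: "'a \<Rightarrow> 'x::metric_space \<Rightarrow> 'x" and x0 :: 'x and \<delta> :: real
  assumes isometric_action: "isometric_action G \<phi>"
    and hyp: "delta_hyperbolic \<delta> (UNIV :: 'x set)" and delta_nonneg: "\<delta> \<ge> 0"
begin

definition len :: "'a \<Rightarrow> real" where
  "len g = dist x0 (\<phi> g x0)"

definition gp :: "'a \<Rightarrow> 'a \<Rightarrow> real" where
  "gp g h = Gromov_product x0 (\<phi> g x0) (\<phi> h x0)"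

sublocale action: group_action G UNIV \<phi>
  using isometric_action by (simp add: isometric_action_def)

lemma dist_action: "g \<in> carrier G \<Longrightarrow> dist (\<phi> g x) (\<phi> g y) = dist x y"
  using isometric_action by (simp add: isometric_action_def)

lemma action_mult: "g \<in> carrier G \<Longrightarrow> h \<in> carrier G \<Longrightarrow> \<phi> (g \<otimes> h) x = \<phi> g (\<phi> h x)"
  by (simp add: action.composition_rule)

lemma action_one: "\<phi> \<one> x = x"
  using action.id_eq_one by (metis UNIV_I restrict_apply')

lemma surj_action: "g \<in> carrier G \<Longrightarrow> surj (\<phi> g)"
  using action.surj_prop by blast

lemma inv_mult_cancel: "g \<in> carrier G \<Longrightarrow> h \<in> carrier G \<Longrightarrow> inv g \<otimes> (g \<otimes> h) = h"
  "g \<in> carrier G \<Longrightarrow> h \<in> carrier G \<Longrightarrow> g \<otimes> (inv g \<otimes> h) = h"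
  by (simp_all flip: m_assoc)

lemma dist_orbit:
  assumes "g \<in> carrier G" "h \<in> carrier G"
  shows "dist (\<phi> g x0) (\<phi> h x0) = len (inv g \<otimes> h)"
proof -
  have "dist (\<phi> g x0) (\<phi> h x0) = dist (\<phi> g x0) (\<phi> g (\<phi> (inv g \<otimes> h) x0))"
    using assms by (simp flip: action_mult add: inv_mult_cancel)
  then show ?thesis using assms by (simp add: dist_action len_def)
qed

lemma len_nonneg: "len g \<ge> 0"
  by (simp add: len_def)

lemma len_one [simp]: "len \<one> = 0"
  by (simp add: len_def action_one)

lemma len_inv [simp]: "g \<in> carrier G \<Longrightarrow> len (inv g) = len g"
  using dist_orbit[of g \<one>] by (simp add: action_one len_def dist_commute)

lemma len_mult:
  assumes "g \<in> carrier G" "h \<in> carrier G"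
  shows "len (g \<otimes> h) \<le> len g + len h"
proof -
  have "dist (\<phi> g x0) (\<phi> (g \<otimes> h) x0) = len h"
    using assms by (simp add: dist_orbit inv_mult_cancel)
  then show ?thesis unfolding len_def using dist_triangle[of x0 "\<phi> (g \<otimes> h) x0" "\<phi> g x0"] by linarith
qed

lemma len_mult_lower:
  assumes "g \<in> carrier G" "h \<in> carrier G"
  shows "len (g \<otimes> h) \<ge> len g - len h" "len (g \<otimes> h) \<ge> len h - len g"
  using len_mult[of "g \<otimes> h" "inv h"] len_mult[of "inv g" "g \<otimes> h"] assms
  by (simp_all add: inv_mult_cancel m_assoc)

lemma gp_eq:
  assumes "g \<in> carrier G" "h \<in> carrier G"
  shows "gp g h = (len g + len h - len (inv g \<otimes> h)) / 2"
  using dist_orbit[OF assms] by (simp add: gp_def Gromov_product_def len_def)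

lemma gp_commute: "gp g h = gp h g"
  by (simp add: gp_def Gromov_product_commute)

lemma gp_le_len: "gp g h \<le> len g"
  by (simp add: gp_def len_def Gromov_product_le_dist)

lemma gp_hyp: "gp g k \<ge> min (gp g h) (gp h k) - \<delta>"
  unfolding gp_def by (rule delta_hyperbolicD[OF hyp])

lemma gp_mult_right:
  assumes "g \<in> carrier G" "h \<in> carrier G"
  shows "gp g (g \<otimes> h) = len g - gp (inv g) h"
  using assms by (simp add: gp_eq inv_mult_cancel field_simps)

lemma gp_left_mult:
  assumes "k \<in> carrier G" "g \<in> carrier G" "h \<in> carrier G"
  shows "gp (k \<otimes> g) (k \<otimes> h) \<ge> gp g h - len k"
proof -
  have "inv (k \<otimes> g) \<otimes> (k \<otimes> h) = inv g \<otimes> h"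
    using assms by (simp add: inv_mult_group m_assoc inv_mult_cancel)
  then show ?thesis
    using assms len_mult_lower(2)[of k g] len_mult_lower(2)[of k h] by (simp add: gp_eq field_simps)
qed


section \<open>Escaping elements\<close>

text \<open>If \<open>g\<^sup>2\<close> moves the basepoint farther than \<open>g\<close> does, by more than the hyperbolicity error, then the powers
  of \<open>g\<close> escape linearly. This is a form of loxodromicity that can be read off from \<open>g\<close> and \<open>g\<^sup>2\<close> alone,
  and whose failure is an inequality that can be used.\<close>

definition escaping :: "'a \<Rightarrow> bool" where
  "escaping g \<longleftrightarrow> len (g \<otimes> g) > len g + 2 * \<delta>"

lemma escaping_inv:
  assumes "g \<in> carrier G" "escaping g"
  shows "escaping (inv g)"
  using assms len_inv[of "g \<otimes> g"] by (simp add: escaping_def inv_mult_group)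

text \<open>The four-point inequality for \<open>1, g, g\<^sup>2, g\<^sup>n\<^sup>+\<^sup>2\<close> says that, unless the length dropped from \<open>g\<^sup>n\<close> to
  \<open>g\<^sup>n\<^sup>+\<^sup>1\<close>, it grows from \<open>g\<^sup>n\<^sup>+\<^sup>1\<close> to \<open>g\<^sup>n\<^sup>+\<^sup>2\<close> at least by the excess of \<open>len (g\<^sup>2)\<close> over \<open>len g + 2\<delta>\<close>.\<close>

lemma escaping_growth:
  assumes g: "g \<in> carrier G" and d: "escaping g"
  obtains e where "e > 0" "\<And>n::nat. len (g [^] Suc n) \<ge> len (g [^] n) + e"
proof -
  define e where "e = len (g \<otimes> g) - len g - 2 * \<delta>"
  have e: "e > 0" using d by (simp add: escaping_def e_def)
  have "len (g [^] Suc n) \<ge> len (g [^] n) + e" for n :: nat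
  proof (induction n)
    case 0
    then show ?case using len_mult[OF g g] delta_nonneg g by (simp add: e_def)
  next
    case (Suc n)
    have step: "g [^] Suc (Suc n) = g \<otimes> g [^] Suc n" "g [^] Suc n = g \<otimes> g [^] n"
      by (rule nat_pow_Suc2[OF g])+
    have [simp]: "inv (g \<otimes> g) \<otimes> g [^] Suc (Suc n) = g [^] n" "inv g \<otimes> g [^] Suc (Suc n) = g [^] Suc n"
        "inv g \<otimes> (g \<otimes> g) = g" "inv (g \<otimes> g) \<otimes> g = inv g"
      unfolding step using g by (simp_all add: inv_mult_group m_assoc inv_mult_cancel)
    have "gp g (g [^] Suc (Suc n)) \<ge> min (gp g (g \<otimes> g)) (gp (g \<otimes> g) (g [^] Suc (Suc n))) - \<delta>"
      by (rule gp_hyp)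
    then show ?case
      using g Suc.IH e
      by (auto simp: gp_eq e_def min_def field_simps split: if_splits
          simp del: Group.nat_pow_Suc local.nat_pow_Suc)
  qed
  with e show ?thesis by (rule that)
qed

lemma escaping_gp_pow:
  assumes g: "g \<in> carrier G" and d: "escaping g"
  obtains e where "e > 0" "\<And>i j::nat. i \<le> j \<Longrightarrow> gp (g [^] i) (g [^] j) \<ge> real i * e"
proof -
  obtain e where e: "e > 0" "\<And>n::nat. len (g [^] Suc n) \<ge> len (g [^] n) + e"
    using escaping_growth[OF g d] by blast
  have add: "len (g [^] (n + m)) \<ge> len (g [^] n) + real m * e" for n m :: nat
  proof (induction m)
    case (Suc m)
    then show ?case using e(2)[of "n + m"] by (simp add: algebra_simps)
  qed simp
  have "gp (g [^] i) (g [^] j) \<ge> real i * e" if "i \<le> j" for i j :: nat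
  proof -
    have "g [^] j = g [^] i \<otimes> g [^] (j - i)" using that g by (simp add: nat_pow_mult)
    then have "inv (g [^] i) \<otimes> g [^] j = g [^] (j - i)" using g by (simp add: inv_mult_cancel)
    then show ?thesis using g add[of "j - i" i] add[of 0 i] that by (simp add: gp_eq)
  qed
  with e(1) show ?thesis by (rule that)
qed

text \<open>If its powers do not escape in this way, \<open>g\<close> turns back at the midpoint, like an elliptic automorphism of a tree.\<close>

lemma gp_inv_if_not_escaping:
  assumes "g \<in> carrier G" "\<not> escaping g"
  shows "gp (inv g) g \<ge> len g / 2 - \<delta>"
  using assms by (simp add: gp_eq escaping_def field_simps)

text \<open>If the paths to \<open>g\<close> and \<open>h\<close> diverged before both midpoints, then so would those to \<open>g\<^sup>\<plusminus>\<^sup>1\<close> and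
  \<open>h\<^sup>\<plusminus>\<^sup>1\<close>. The product \<open>g h\<close> would then start along \<open>g\<close> and its inverse along \<open>h\<^sup>-\<^sup>1\<close>, two directions that
  part long before the midpoint of \<open>g h\<close>, although \<open>g h\<close> turns back there.\<close>

lemma gp_lower_if_not_escaping:
  assumes g: "g \<in> carrier G" "\<not> escaping g" and h: "h \<in> carrier G" "\<not> escaping h"
    and gh: "\<not> escaping (g \<otimes> h)"
  shows "gp g h \<ge> min (len g) (len h) / 2 - 3 * \<delta>"
proof (rule ccontr)
  assume neg: "\<not> ?thesis"
  define p m where "p = gp g h" and "m = min (len g) (len h) / 2"
  have pm: "p < m - 3 * \<delta>" using neg by (simp add: p_def m_def)
  have m: "m \<le> len g / 2" "m \<le> len h / 2" by (auto simp: m_def)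
  have g': "gp g (inv g) \<ge> m - \<delta>" and h': "gp h (inv h) \<ge> m - \<delta>"
    using gp_inv_if_not_escaping[OF g] gp_inv_if_not_escaping[OF h] m by (simp_all add: gp_commute)
  have a: "gp (inv g) h \<le> p + \<delta>"
    using gp_hyp[of g "inv g" h] g' pm delta_nonneg unfolding p_def by (auto simp: min_def split: if_splits)
  have b: "gp g (inv h) \<le> p + \<delta>"
    using gp_hyp[of g "inv h" h] h' pm delta_nonneg unfolding p_def
    by (auto simp: min_def gp_commute split: if_splits)
  have 1: "gp g (g \<otimes> h) \<ge> 2 * m - p - \<delta>"
    using a m g h by (simp add: gp_mult_right)
  have 2: "gp (inv (g \<otimes> h)) (inv h) \<ge> 2 * m - p - \<delta>"
    using a m g h gp_mult_right[of "inv h" "inv g"] by (simp add: gp_commute inv_mult_group)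
  have "len (g \<otimes> h) = len g + len h - 2 * gp (inv g) h"
    using g h by (simp add: gp_eq field_simps)
  then have 3: "gp (g \<otimes> h) (inv (g \<otimes> h)) \<ge> 2 * m - p - 2 * \<delta>"
    using gp_inv_if_not_escaping[of "g \<otimes> h"] g(1) h(1) gh a m
    unfolding gp_commute[of "g \<otimes> h"] by (auto simp: field_simps simp del: len_inv)
  have "gp g (inv h) \<ge> 2 * m - p - 4 * \<delta>"
    using 1 2 3 gp_hyp[of g "g \<otimes> h" "inv h"] gp_hyp[of "g \<otimes> h" "inv (g \<otimes> h)" "inv h"] delta_nonneg
    by linarith
  then show False using b pm delta_nonneg by linarith
qed

section \<open>Limits of group elements at infinity\<close>

definition conv :: "(nat \<Rightarrow> 'a) \<Rightarrow> bool" where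
  "conv g \<longleftrightarrow> range g \<subseteq> carrier G \<and> (\<lambda>i. \<phi> (g i) x0) \<in> Gromov_sequences x0"

definition endpoint :: "(nat \<Rightarrow> 'a) \<Rightarrow> (nat \<Rightarrow> 'x) set" where
  "endpoint g = Gromov_equiv x0 `` {\<lambda>i. \<phi> (g i) x0}"

lemma conv_carrier: "conv g \<Longrightarrow> g i \<in> carrier G"
  by (auto simp: conv_def)

lemma conv_iff:
  "conv g \<longleftrightarrow> range g \<subseteq> carrier G \<and> (\<forall>Z. \<exists>I. \<forall>i\<ge>I. \<forall>j\<ge>I. gp (g i) (g j) \<ge> Z)"
  by (simp add: conv_def Gromov_sequences_iff gp_def)

lemma endpoint_in_boundary: "conv g \<Longrightarrow> endpoint g \<in> Gromov_boundary x0"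
  by (simp add: conv_def endpoint_def Gromov_boundary_def quotientI)

lemma equiv_boundary: "equiv (Gromov_sequences x0) (Gromov_equiv x0)"
  using hyp delta_nonneg by (intro equiv_Gromov_equiv) (auto simp: Gromov_hyperbolic_def)

lemma endpoint_eq_iff_equiv:
  assumes "conv g" "conv h"
  shows "endpoint g = endpoint h \<longleftrightarrow> ((\<lambda>i. \<phi> (g i) x0), (\<lambda>i. \<phi> (h i) x0)) \<in> Gromov_equiv x0"
  using assms eq_equiv_class_iff[OF equiv_boundary] by (simp add: conv_def endpoint_def)

lemma endpoint_eqI:
  assumes "conv g" "conv h" "\<And>Z. \<exists>I. \<forall>i\<ge>I. gp (g i) (h i) \<ge> Z"
  shows "endpoint g = endpoint h"
  using assms endpoint_eq_iff_equiv[of g h] by (simp add: Gromov_equiv_iff conv_def gp_def)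

lemma endpoint_neq_bounded:
  assumes "conv g" "conv h" "endpoint g \<noteq> endpoint h"
  shows "\<exists>p I. \<forall>k\<ge>I. \<forall>l\<ge>I. gp (g k) (h l) \<le> p"
proof -
  have "((\<lambda>i. \<phi> (g i) x0), (\<lambda>i. \<phi> (h i) x0)) \<notin> Gromov_equiv x0"
    using assms endpoint_eq_iff_equiv by blast
  then show ?thesis
    using not_Gromov_equiv_bounded[OF hyp, of "\<lambda>i. \<phi> (g i) x0" x0 "\<lambda>i. \<phi> (h i) x0"] assms(1,2)
    unfolding conv_def gp_def by metis
qed

lemma conv_len:
  assumes "conv g"
  shows "\<exists>I. \<forall>i\<ge>I. len (g i) \<ge> Z"
proof -
  obtain I where "\<forall>i\<ge>I. \<forall>j\<ge>I. gp (g i) (g j) \<ge> Z" using assms unfolding conv_iff by blast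
  then have "len (g i) \<ge> Z" if "i \<ge> I" for i using gp_le_len[of "g i" "g i"] that by force
  then show ?thesis by blast
qed

lemma boundary_map_endpoint:
  assumes k: "k \<in> carrier G" and g: "conv g"
  shows "conv (\<lambda>i. k \<otimes> g i)" "boundary_map (\<phi> k) (endpoint g) = endpoint (\<lambda>i. k \<otimes> g i)"
proof -
  have *: "(\<lambda>i. \<phi> (k \<otimes> g i) x0) = \<phi> k \<circ> (\<lambda>i. \<phi> (g i) x0)"
    using k conv_carrier[OF g] by (simp add: action_mult fun_eq_iff)
  show "conv (\<lambda>i. k \<otimes> g i)"
    using g k isometry_Gromov_equiv(1)[of "\<phi> k" "\<lambda>i. \<phi> (g i) x0" x0] dist_action[OF k]
    by (auto simp: conv_def *)
  show "boundary_map (\<phi> k) (endpoint g) = endpoint (\<lambda>i. k \<otimes> g i)"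
    unfolding endpoint_def * using dist_action[OF k] surj_action[OF k] by (rule boundary_map_class)
qed

lemma endpoint_mult_right:
  assumes k: "k \<in> carrier G" and g: "conv g"
  shows "conv (\<lambda>i. g i \<otimes> k)" "endpoint (\<lambda>i. g i \<otimes> k) = endpoint g"
proof -
  have equiv: "((\<lambda>i. \<phi> (g i) x0), (\<lambda>i. \<phi> (g i \<otimes> k) x0)) \<in> Gromov_equiv x0"
  proof (rule Gromov_equiv_if_close)
    show "dist (\<phi> (g i) x0) (\<phi> (g i \<otimes> k) x0) \<le> len k" for i
      using k conv_carrier[OF g, of i] by (simp add: dist_orbit inv_mult_cancel)
  qed (use g in \<open>simp add: conv_def\<close>)
  then show "conv (\<lambda>i. g i \<otimes> k)"
    using g k unfolding conv_def Gromov_equiv_iff by auto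
  then show "endpoint (\<lambda>i. g i \<otimes> k) = endpoint g"
    using endpoint_eq_iff_equiv[OF g] equiv by metis
qed

lemma centraliser_fixes_endpoint:
  assumes "k \<in> carrier G" "conv g" "\<And>i. k \<otimes> g i = g i \<otimes> k"
  shows "boundary_map (\<phi> k) (endpoint g) = endpoint g"
  using boundary_map_endpoint[OF assms(1,2)] endpoint_mult_right[OF assms(1,2)] assms(3) by simp

lemma endpoint_conj:
  assumes "k \<in> carrier G" "conv g"
  shows "conv (\<lambda>i. k \<otimes> g i \<otimes> inv k)"
    "endpoint (\<lambda>i. k \<otimes> g i \<otimes> inv k) = boundary_map (\<phi> k) (endpoint g)"
  using boundary_map_endpoint[OF assms]
    endpoint_mult_right[of "inv k" "\<lambda>i. k \<otimes> g i"] assms by auto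

lemma boundary_map_mult:
  assumes "g \<in> carrier G" "h \<in> carrier G"
  shows "boundary_map (\<phi> (g \<otimes> h)) \<xi> = boundary_map (\<phi> g) (boundary_map (\<phi> h) \<xi>)"
  using assms by (simp add: boundary_map_def image_image comp_def action_mult)

lemma boundary_map_one: "boundary_map (\<phi> \<one>) \<xi> = \<xi>"
  by (simp add: boundary_map_def action_one comp_def)

lemma boundary_map_cancel:
  assumes "g \<in> carrier G" "boundary_map (\<phi> g) \<xi> = boundary_map (\<phi> g) \<eta>"
  shows "\<xi> = \<eta>"
proof -
  have "\<xi> = boundary_map (\<phi> (inv g)) (boundary_map (\<phi> g) \<xi>)"
       "\<eta> = boundary_map (\<phi> (inv g)) (boundary_map (\<phi> g) \<eta>)"
    using assms(1) by (simp_all add: boundary_map_one flip: boundary_map_mult)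
  then show ?thesis using assms(2) by simp
qed

text \<open>An unbounded set closed under products and without escaping elements has a single limit
  point, because any two of its long elements have a large Gromov product.\<close>

lemma conv_if_no_escaping:
  assumes H: "H \<subseteq> carrier G" "\<And>x y. x \<in> H \<Longrightarrow> y \<in> H \<Longrightarrow> x \<otimes> y \<in> H" "\<And>x. x \<in> H \<Longrightarrow> \<not> escaping x"
    and g: "\<And>i::nat. g i \<in> H" "\<And>i. len (g i) \<ge> real i - C"
    and h: "\<And>i::nat. h i \<in> H" "\<And>i. len (h i) \<ge> real i - C"
  shows "conv g" "endpoint g = endpoint h"
proof -
  define I where "I Z = nat \<lceil>2 * Z + 6 * \<delta> + C\<rceil>" for Z
  have gp: "gp x y \<ge> Z" if xy: "x \<in> H" "y \<in> H" and len: "len x \<ge> real i - C" "len y \<ge> real j - C"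
      and ij: "i \<ge> I Z" "j \<ge> I Z" for x y i j Z
  proof -
    have "gp x y \<ge> min (len x) (len y) / 2 - 3 * \<delta>"
      using xy H by (intro gp_lower_if_not_escaping) auto
    moreover have "real i \<ge> 2 * Z + 6 * \<delta> + C" "real j \<ge> 2 * Z + 6 * \<delta> + C"
      using ij unfolding I_def by linarith+
    ultimately show ?thesis using len by (auto simp: min_def split: if_splits)
  qed
  have conv: "conv u" if u: "\<And>i::nat. u i \<in> H" "\<And>i. len (u i) \<ge> real i - C" for u
    unfolding conv_iff
  proof (intro conjI allI exI impI)
    show "Z \<le> gp (u i) (u j)" if "I Z \<le> i" "I Z \<le> j" for Z i j
      using u(1) u(1) u(2) u(2) that by (rule gp)
  qed (use u(1) H(1) in auto)
  show "conv g" using g by (rule conv)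
  show "endpoint g = endpoint h"
  proof (rule endpoint_eqI[OF conv[OF g] conv[OF h]], intro exI allI impI)
    show "Z \<le> gp (g i) (h i)" if "I Z \<le> i" for Z i
      using g(1) h(1) g(2) h(2) that that by (rule gp)
  qed
qed


section \<open>Commuting elements\<close>

lemma inv_commute:
  assumes "x \<in> carrier G" "y \<in> carrier G" "x \<otimes> y = y \<otimes> x"
  shows "inv x \<otimes> y = y \<otimes> inv x"
proof -
  have "inv x \<otimes> y = inv x \<otimes> (y \<otimes> x) \<otimes> inv x" using assms(1,2) by (simp add: m_assoc)
  also have "\<dots> = y \<otimes> inv x" unfolding assms(3)[symmetric] using assms(1,2) by (simp add: inv_mult_cancel)
  finally show ?thesis .
qed

lemma conj_int_pow:
  assumes "k \<in> carrier G" "a \<in> carrier G"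
  shows "(k \<otimes> a \<otimes> inv k) [^] (n::int) = k \<otimes> a [^] n \<otimes> inv k"
proof -
  have "(\<lambda>x. k \<otimes> x \<otimes> inv k) \<in> hom G G"
    using assms(1) by (auto intro!: homI simp: m_assoc inv_mult_cancel)
  from hom_int_pow[OF this assms(2) is_group is_group] show ?thesis by (rule sym)
qed

lemma int_pow_commute:
  assumes "x \<in> carrier G" "y \<in> carrier G" "x \<otimes> y = y \<otimes> x"
  shows "x [^] (n::int) \<otimes> y = y \<otimes> x [^] n"
proof -
  have "y \<otimes> x \<otimes> inv y = x" unfolding assms(3)[symmetric] using assms(1,2) by (simp add: m_assoc)
  then have "x [^] n \<otimes> y = y \<otimes> x [^] n \<otimes> inv y \<otimes> y" using conj_int_pow[OF assms(2,1), of n] by simp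
  also have "\<dots> = y \<otimes> x [^] n" using assms(1,2) by (simp add: m_assoc)
  finally show ?thesis .
qed

lemma commute_if_commutator_eq_one:
  assumes "x \<in> carrier G" "y \<in> carrier G" "commutator G x y = \<one>"
  shows "x \<otimes> y = y \<otimes> x"
proof -
  have "x \<otimes> y = commutator G x y \<otimes> (y \<otimes> x)"
    using assms(1,2) by (simp add: commutator_def m_assoc inv_mult_cancel)
  then show ?thesis using assms by simp
qed

text \<open>If \<open>g\<^sup>-\<^sup>1\<close> and \<open>h\<close> part, then \<open>g h\<close> follows \<open>g\<close> almost to its end; if \<open>h\<^sup>-\<^sup>1\<close> and \<open>g\<close> part, then \<open>h g\<close>
  follows \<open>h\<close>. When both hold and \<open>g h = h g\<close>, the elements \<open>g\<close> and \<open>h\<close> follow each other.\<close>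

lemma commuting_endpoints:
  assumes g: "conv g" "conv (\<lambda>i. inv (g i))" and h: "conv h" "conv (\<lambda>i. inv (h i))"
    and comm: "\<And>i j. g i \<otimes> h j = h j \<otimes> g i"
  shows "endpoint g = endpoint h \<or> endpoint (\<lambda>i. inv (g i)) = endpoint h \<or> endpoint g = endpoint (\<lambda>i. inv (h i))"
proof (rule ccontr)
  assume neg: "\<not> ?thesis"
  obtain p1 I1 where 1: "\<forall>k\<ge>I1. \<forall>l\<ge>I1. gp (g k) (h l) \<le> p1"
    using endpoint_neq_bounded[OF g(1) h(1)] neg by blast
  obtain p2 I2 where 2: "\<forall>k\<ge>I2. \<forall>l\<ge>I2. gp (inv (g k)) (h l) \<le> p2"
    using endpoint_neq_bounded[OF g(2) h(1)] neg by blast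
  obtain p3 I3 where 3: "\<forall>k\<ge>I3. \<forall>l\<ge>I3. gp (g k) (inv (h l)) \<le> p3"
    using endpoint_neq_bounded[OF g(1) h(2)] neg by blast
  obtain I4 where 4: "\<forall>i\<ge>I4. len (g i) \<ge> p1 + p2 + \<delta> + 1 + \<bar>p1\<bar>"
    using conv_len[OF g(1)] by blast
  obtain I5 where 5: "\<forall>i\<ge>I5. len (h i) \<ge> p1 + p3 + \<delta> + 1 + \<bar>p1\<bar>"
    using conv_len[OF h(1)] by blast
  define n where "n = Max {I1, I2, I3, I4, I5}"
  have n: "n \<ge> I1" "n \<ge> I2" "n \<ge> I3" "n \<ge> I4" "n \<ge> I5" by (simp_all add: n_def)
  have c: "g n \<in> carrier G" "h n \<in> carrier G" using g h conv_carrier by auto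
  have "gp (g n) (g n \<otimes> h n) \<ge> len (g n) - p2"
    using gp_mult_right[OF c] 2[rule_format, OF n(2) n(2)] by simp
  moreover have "gp (g n \<otimes> h n) (h n) \<ge> len (h n) - p3"
    using gp_mult_right[OF c(2,1)] 3[rule_format, OF n(3) n(3)] by (simp add: comm gp_commute)
  ultimately show False
    using gp_hyp[of "g n" "g n \<otimes> h n" "h n"] 1[rule_format, OF n(1) n(1)] 4[rule_format, OF n(4)] 5[rule_format, OF n(5)] by linarith
qed

text \<open>The previous lemma applied with either element inverted. The hypothesis on coincidence of
  endpoints means that the two elements are of the same type, both parabolic or both loxodromic; it
  is automatic for conjugates.\<close>

lemma commuting_endpoint_pairs:
  assumes g: "conv g" "conv (\<lambda>i. inv (g i))" and h: "conv h" "conv (\<lambda>i. inv (h i))"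
    and comm: "\<And>i j. g i \<otimes> h j = h j \<otimes> g i"
    and type: "endpoint g = endpoint (\<lambda>i. inv (g i)) \<longleftrightarrow> endpoint h = endpoint (\<lambda>i. inv (h i))"
  shows "{endpoint g, endpoint (\<lambda>i. inv (g i))} = {endpoint h, endpoint (\<lambda>i. inv (h i))}"
proof -
  have c: "g i \<in> carrier G" "h i \<in> carrier G" for i using g h conv_carrier by auto
  have comm1: "inv (g i) \<otimes> h j = h j \<otimes> inv (g i)" for i j
    by (rule inv_commute[OF c comm])
  have comm2: "g i \<otimes> inv (h j) = inv (h j) \<otimes> g i" for i j
    by (rule inv_commute[OF c(2,1) comm[symmetric], symmetric])
  have comm3: "inv (g i) \<otimes> inv (h j) = inv (h j) \<otimes> inv (g i)" for i j
    by (rule inv_commute[OF c(1) inv_closed[OF c(2)] comm2])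
  have inv_inv: "(\<lambda>i. inv (inv (g i))) = g" "(\<lambda>i. inv (inv (h i))) = h" using c by auto
  have "conv (\<lambda>i. inv (inv (g i)))" "conv (\<lambda>i. inv (inv (h i)))"
    unfolding inv_inv by (rule g h)+
  note g' = g(2) this(1) and h' = h(2) this(2)
  show ?thesis
    using commuting_endpoints[OF g h comm] commuting_endpoints[OF g' h comm1, unfolded inv_inv]
      commuting_endpoints[OF g h' comm2, unfolded inv_inv]
      commuting_endpoints[OF g' h' comm3, unfolded inv_inv] type
    unfolding doubleton_eq_iff by metis
qed


section \<open>Elements with unbounded powers\<close>

definition elliptic :: "'a \<Rightarrow> bool" where
  "elliptic a \<longleftrightarrow> (\<exists>C. \<forall>n::int. len (a [^] n) \<le> C)"

lemma escaping_pow_gp_ge: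
  assumes s: "s \<in> carrier G" "escaping s"
  obtains I where "\<And>i j. i \<ge> I \<Longrightarrow> j \<ge> I \<Longrightarrow> gp (s [^] (i::nat)) (s [^] (j::nat)) \<ge> Z"
proof -
  obtain e where e: "e > 0" "\<And>i j::nat. i \<le> j \<Longrightarrow> gp (s [^] i) (s [^] j) \<ge> real i * e"
    using escaping_gp_pow[OF s] by blast
  have "gp (s [^] i) (s [^] j) \<ge> Z" if ij: "i \<ge> nat \<lceil>Z / e\<rceil>" "j \<ge> nat \<lceil>Z / e\<rceil>" for i j :: nat
  proof -
    have "Z / e \<le> real (min i j)" using ij by linarith
    then have "Z \<le> real (min i j) * e" using e(1) by (simp add: field_simps)
    then show ?thesis
    proof (cases "i \<le> j")
      case True
      then show ?thesis using \<open>Z \<le> _\<close> e(2)[of i j] by simp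
    next
      case False
      then have "Z \<le> gp (s [^] j) (s [^] i)" using \<open>Z \<le> _\<close> e(2)[of j i] by simp
      then show ?thesis by (simp only: gp_commute)
    qed
  qed
  then show ?thesis by (rule that)
qed

lemma escaping_conv:
  assumes s: "s \<in> carrier G" "escaping s"
  shows "conv (\<lambda>i::nat. s [^] i)"
  unfolding conv_iff
proof (intro conjI allI)
  fix Z
  obtain I where "\<And>i j. i \<ge> I \<Longrightarrow> j \<ge> I \<Longrightarrow> gp (s [^] (i::nat)) (s [^] (j::nat)) \<ge> Z"
    using escaping_pow_gp_ge[OF s] by blast
  then show "\<exists>I. \<forall>i\<ge>I. \<forall>j\<ge>I. Z \<le> gp (s [^] (i::nat)) (s [^] (j::nat))" by blast
qed (use s in auto)

lemma elliptic_not_escaping: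
  assumes a: "a \<in> carrier G" "elliptic a"
  shows "\<not> escaping a"
proof
  assume d: "escaping a"
  obtain C where C: "\<And>n::int. len (a [^] n) \<le> C" using a(2) by (auto simp: elliptic_def)
  obtain I :: nat where "\<forall>i\<ge>I. len (a [^] i) \<ge> C + 1" using conv_len[OF escaping_conv[OF a(1) d]] by blast
  from this[rule_format, of I] show False using C[of "int I"] by (simp add: int_pow_int)
qed

text \<open>If some power is escaping, its powers run between two distinct ends (the loxodromic case). Otherwise
  the cyclic group is unbounded without escaping elements and has one limit point (the parabolic case).\<close>

lemma nonelliptic_conv:
  assumes a: "a \<in> carrier G" "\<not> elliptic a"
  obtains N :: "nat \<Rightarrow> int" where "conv (\<lambda>i. a [^] N i)" "conv (\<lambda>i. inv (a [^] N i))"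
proof (cases "\<exists>m::int. escaping (a [^] m)")
  case True
  then obtain m :: int where m: "escaping (a [^] m)" by blast
  have eq: "(a [^] m) [^] i = a [^] (m * int i)" "(inv (a [^] m)) [^] i = inv (a [^] (m * int i))" for i :: nat
    using a(1) int_pow_pow[OF a(1), of m "int i"] by (simp_all add: int_pow_int nat_pow_inv)
  show ?thesis
  proof (rule that)
    show "conv (\<lambda>i. a [^] (m * int i))"
      using escaping_conv[OF _ m] a(1) by (simp add: eq)
    show "conv (\<lambda>i. inv (a [^] (m * int i)))"
      using escaping_conv[OF _ escaping_inv[OF _ m]] a(1) by (simp add: eq)
  qed
next
  case False
  have "\<exists>n::int. len (a [^] n) \<ge> real i" for i :: nat
    using a(2) unfolding elliptic_def by (meson linear)
  then obtain N :: "nat \<Rightarrow> int" where N: "\<And>i. len (a [^] N i) \<ge> real i" by metis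
  let ?H = "range (\<lambda>n::int. a [^] n)"
  have mult: "x \<otimes> y \<in> ?H" if "x \<in> ?H" "y \<in> ?H" for x y
    using that a(1) by (auto simp flip: int_pow_mult)
  have inv: "inv (a [^] n) \<in> ?H" for n :: int
    using a(1) by (simp flip: int_pow_neg)
  have "conv (\<lambda>i. a [^] N i)"
    by (rule conv_if_no_escaping(1)[where H = ?H and h = "\<lambda>i. a [^] N i" and C = 0])
       (use a(1) N mult False in auto)
  moreover have "conv (\<lambda>i. inv (a [^] N i))"
    by (rule conv_if_no_escaping(1)[where H = ?H and h = "\<lambda>i. a [^] N i" and C = 0])
       (use a(1) N mult inv False in auto)
  ultimately show ?thesis by (rule that)
qed

text \<open>Limit pairs pass along a chain of commuting conjugates, and commuting with the last conjugate
  forces \<open>b\<close> to fix the common pair.\<close>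

lemma commuting_chain_fixes_endpoint:
  assumes a: "a \<in> carrier G" and b: "b \<in> carrier G" and g: "g \<in> carrier G" and h: "h \<in> carrier G"
    and N: "conv (\<lambda>i. a [^] (N i :: int))" "conv (\<lambda>i. inv (a [^] N i))"
    and a': "a' = g \<otimes> a \<otimes> inv g" "a' \<otimes> a = a \<otimes> a'"
    and a'': "a'' = h \<otimes> a' \<otimes> inv h" "a' \<otimes> a'' = a'' \<otimes> a'"
    and ab: "a'' \<otimes> b = b \<otimes> a''"
  shows "boundary_map (\<phi> b) (endpoint (\<lambda>i. a [^] N i)) = endpoint (\<lambda>i. a [^] N i)"
proof -
  define ends where "ends x = {endpoint (\<lambda>i. x [^] N i), endpoint (\<lambda>i. inv (x [^] N i))}" for x
  have conj: "conv (\<lambda>i. y [^] N i)" "conv (\<lambda>i. inv (y [^] N i))" "ends x = ends y"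
    if x: "x \<in> carrier G" and k: "k \<in> carrier G" and y: "y = k \<otimes> x \<otimes> inv k" "x \<otimes> y = y \<otimes> x"
      and c: "conv (\<lambda>i. x [^] N i)" "conv (\<lambda>i. inv (x [^] N i))" for x y k
  proof -
    have yc: "y \<in> carrier G" using x k y(1) by simp
    have pow: "(\<lambda>i. y [^] N i) = (\<lambda>i. k \<otimes> x [^] N i \<otimes> inv k)"
         "(\<lambda>i. inv (y [^] N i)) = (\<lambda>i. k \<otimes> inv (x [^] N i) \<otimes> inv k)"
      unfolding y(1) conj_int_pow[OF k x] using x k by (simp_all add: inv_mult_group m_assoc)
    note e = endpoint_conj[OF k c(1), folded pow] endpoint_conj[OF k c(2), folded pow]
    show "conv (\<lambda>i. y [^] N i)" "conv (\<lambda>i. inv (y [^] N i))" by (rule e)+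
    have comm: "x [^] N i \<otimes> y [^] N j = y [^] N j \<otimes> x [^] N i" for i j
      using int_pow_commute[OF yc x y(2)[symmetric], of "N j"] x yc
      by (intro int_pow_commute) simp_all
    have "endpoint (\<lambda>i. x [^] N i) = endpoint (\<lambda>i. inv (x [^] N i)) \<longleftrightarrow>
        endpoint (\<lambda>i. y [^] N i) = endpoint (\<lambda>i. inv (y [^] N i))"
      unfolding e(2,4) using boundary_map_cancel[OF k] by metis
    then show "ends x = ends y"
      unfolding ends_def by (rule commuting_endpoint_pairs[OF c e(1,3) comm])
  qed
  have car: "a' \<in> carrier G" "a'' \<in> carrier G" using a g h a'(1) a''(1) by simp_all
  note 1 = conj[OF a g a'(1) a'(2)[symmetric] N]
  note 2 = conj[OF car(1) h a'' 1(1,2)]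
  have comm: "b \<otimes> a'' [^] N i = a'' [^] N i \<otimes> b" for i
    using int_pow_commute[OF car(2) b ab] by simp
  have comm': "b \<otimes> inv (a'' [^] N i) = inv (a'' [^] N i) \<otimes> b" for i
    using inv_commute[OF int_pow_closed[OF car(2)] b comm[symmetric]] by simp
  have "boundary_map (\<phi> b) \<xi> = \<xi>" if "\<xi> \<in> ends a''" for \<xi>
    using that centraliser_fixes_endpoint[OF b 2(1) comm] centraliser_fixes_endpoint[OF b 2(2) comm']
    by (auto simp: ends_def)
  moreover have "endpoint (\<lambda>i. a [^] N i) \<in> ends a''"
    unfolding 2(3)[symmetric] 1(3)[symmetric] by (simp add: ends_def)
  ultimately show ?thesis by blast
qed


section \<open>Global fixed points\<close>

abbreviation fixes_end :: "'a \<Rightarrow> (nat \<Rightarrow> 'x) set \<Rightarrow> bool" where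
  "fixes_end g \<xi> \<equiv> boundary_map (\<phi> g) \<xi> = \<xi>"

lemma generators_fix_end:
  assumes A: "A \<subseteq> carrier G" "boundedly_generated_by G A"
    and gen: "\<And>a. a \<in> A \<Longrightarrow> fixes_end a \<xi>" and g: "g \<in> carrier G"
  shows "fixes_end g \<xi>"
proof -
  have "list_mult G xs \<in> carrier G \<and> fixes_end (list_mult G xs) \<xi>" if "set xs \<subseteq> A" for xs
    using that
  proof (induction xs)
    case Nil
    then show ?case by (simp add: list_mult_def boundary_map_one)
  next
    case (Cons x xs)
    have "list_mult G (x # xs) = x \<otimes> list_mult G xs" by (simp add: list_mult_def)
    then show ?case using Cons A(1) gen by (auto simp: boundary_map_mult)
  qed
  then show ?thesis using A(2) g unfolding boundedly_generated_by_def by metis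
qed

lemma fixed_end_if_no_escaping:
  assumes nd: "\<And>g. g \<in> carrier G \<Longrightarrow> \<not> escaping g"
    and unb: "\<And>C. \<exists>g\<in>carrier G. len g \<ge> C"
  shows "\<exists>\<xi>\<in>Gromov_boundary x0. \<forall>g\<in>carrier G. fixes_end g \<xi>"
proof -
  have "\<forall>i::nat. \<exists>g\<in>carrier G. len g \<ge> real i" using unb by blast
  then obtain g :: "nat \<Rightarrow> 'a" where g: "\<And>i. g i \<in> carrier G" "\<And>i. len (g i) \<ge> real i" by metis
  have one_end: "conv g \<and> endpoint g = endpoint (\<lambda>i. k \<otimes> g i)" if k: "k \<in> carrier G" for k
  proof -
    have "len (k \<otimes> g i) \<ge> real i - len k" "len (g i) \<ge> real i - len k" for i
      using len_mult_lower(2)[OF k g(1)[of i]] g(2)[of i] len_nonneg[of k] by linarith+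
    then show ?thesis
      using conv_if_no_escaping[of "carrier G" g "len k" "\<lambda>i. k \<otimes> g i"] nd g(1) k by simp
  qed
  have c: "conv g" using one_end[OF one_closed] by simp
  have "fixes_end k (endpoint g)" if "k \<in> carrier G" for k
    using boundary_map_endpoint(2)[OF that c] one_end[OF that] by simp
  then show ?thesis using endpoint_in_boundary[OF c] by blast
qed

text \<open>A group is not the union of two proper subgroups.\<close>

lemma fixes_one_of_two_ends:
  assumes "\<And>b. b \<in> carrier G \<Longrightarrow> fixes_end b \<xi> \<or> fixes_end b \<eta>"
  shows "(\<forall>b\<in>carrier G. fixes_end b \<xi>) \<or> (\<forall>b\<in>carrier G. fixes_end b \<eta>)"
proof (rule ccontr)
  assume "\<not> ?thesis"
  then obtain b c where bc: "b \<in> carrier G" "\<not> fixes_end b \<xi>" "c \<in> carrier G" "\<not> fixes_end c \<eta>" by blast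
  have b: "fixes_end b \<eta>" and c: "fixes_end c \<xi>" using assms bc by blast+
  have "boundary_map (\<phi> b) (boundary_map (\<phi> c) \<xi>) = \<xi> \<or>
      boundary_map (\<phi> b) (boundary_map (\<phi> c) \<eta>) = \<eta>"
    using assms[of "b \<otimes> c"] bc by (simp add: boundary_map_mult)
  then show False
  proof
    assume "boundary_map (\<phi> b) (boundary_map (\<phi> c) \<xi>) = \<xi>"
    then show False using c bc by simp
  next
    assume "boundary_map (\<phi> b) (boundary_map (\<phi> c) \<eta>) = \<eta>"
    then have "boundary_map (\<phi> b) (boundary_map (\<phi> c) \<eta>) = boundary_map (\<phi> b) \<eta>" using b by simp
    then show False using boundary_map_cancel[OF bc(1)] bc(4) by blast
  qed
qed

text \<open>Any two elements almost fix a common point at infinity: when the products are large, the far point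
  \<open>y\<close> and its images under both elements lie in the same direction from the basepoint.\<close>

definition shared_directions :: bool where
  "shared_directions \<longleftrightarrow>
     (\<forall>c\<in>carrier G. \<forall>d\<in>carrier G. \<forall>R. \<exists>y\<in>carrier G. gp y (c \<otimes> y) \<ge> R \<and> gp y (d \<otimes> y) \<ge> R)"

text \<open>A direction almost fixed by a large power \<open>a\<^sup>N\<close> points to one of the two ends of \<open>a\<close>, since otherwise
  \<open>a\<^sup>N\<close> would carry it towards its attracting end. If \<open>b\<close> almost fixes the
  same direction for every \<open>N\<close>, it fixes one of these ends.\<close>

lemma fixes_end_of_escaping:
  assumes sd: shared_directions
    and a: "a \<in> carrier G" "escaping a" and b: "b \<in> carrier G"
  shows "fixes_end b (endpoint (\<lambda>i::nat. a [^] i)) \<or> fixes_end b (endpoint (\<lambda>i::nat. inv a [^] i))"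
proof (rule ccontr)
  assume neg: "\<not> ?thesis"
  have a': "inv a \<in> carrier G" "escaping (inv a)" using a escaping_inv by auto
  note s = escaping_conv[OF a] and t = escaping_conv[OF a']
  note bs = boundary_map_endpoint[OF b s] and bt = boundary_map_endpoint[OF b t]
  obtain p1 I1 where 1: "\<forall>k\<ge>I1. \<forall>l\<ge>I1. gp (b \<otimes> a [^] (k::nat)) (a [^] (l::nat)) \<le> p1"
    using endpoint_neq_bounded[OF bs(1) s] neg bs(2) by auto
  obtain p2 I2 where 2: "\<forall>k\<ge>I2. \<forall>l\<ge>I2. gp (b \<otimes> inv a [^] (k::nat)) (inv a [^] (l::nat)) \<le> p2"
    using endpoint_neq_bounded[OF bt(1) t] neg bt(2) by auto
  define p where "p = max p1 p2 + len b + 2 * \<delta> + 1"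
  obtain I3 :: nat where 3: "\<forall>i\<ge>I3. len (a [^] i) \<ge> 2 * p + 2 * \<delta> + 1" using conv_len[OF s] by blast
  define n where "n = max I1 (max I2 I3)"
  define u where "u = a [^] n"
  have u: "u \<in> carrier G" using a by (simp add: u_def)
  have n: "n \<ge> I1" "n \<ge> I2" "n \<ge> I3" by (simp_all add: n_def)
  have bound: "gp (b \<otimes> u) u \<le> p1" "gp (b \<otimes> inv u) (inv u) \<le> p2" "len u \<ge> 2 * p + 2 * \<delta> + 1"
    using 1[rule_format, OF n(1) n(1)] 2[rule_format, OF n(2) n(2)] 3[rule_format, OF n(3)] a(1)
    by (simp_all add: u_def nat_pow_inv)
  obtain y where y: "y \<in> carrier G" "gp y (u \<otimes> y) \<ge> p + \<delta> + 1" "gp y (b \<otimes> y) \<ge> p + \<delta> + 1"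
    using sd u b unfolding shared_directions_def by blast
  have toward_end: "gp y u > p \<or> gp y (inv u) > p"
  proof (rule ccontr)
    assume "\<not> ?thesis"
    then have small: "gp y u \<le> p" "gp (inv u) y \<le> p" by (simp_all add: gp_commute)
    have "gp (u \<otimes> y) u = len u - gp (inv u) y"
      using gp_mult_right[OF u y(1)] gp_commute by metis
    then show False
      using gp_hyp[of y "u \<otimes> y" u] y(2) small bound(3) delta_nonneg by linarith
  qed
  have turn: "gp (b \<otimes> v) v > max p1 p2" if v: "v \<in> carrier G" "gp y v > p" for v
  proof -
    have "gp (b \<otimes> v) (b \<otimes> y) \<ge> gp v y - len b" by (rule gp_left_mult[OF b v(1) y(1)])
    then show ?thesis
      using gp_hyp[of "b \<otimes> v" "b \<otimes> y" v] gp_hyp[of "b \<otimes> y" y v] v(2) y(3) delta_nonneg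
        gp_commute[of v y] gp_commute[of "b \<otimes> y" y] len_nonneg[of b] p_def
      by linarith
  qed
  from toward_end show False
  proof
    assume "gp y u > p"
    then show False using turn[OF u] bound(1) by simp
  next
    assume "gp y (inv u) > p"
    then show False using turn[OF inv_closed[OF u]] bound(2) by simp
  qed
qed

lemma fixed_end_if_shared_directions:
  assumes sd: shared_directions and unb: "\<And>C. \<exists>g\<in>carrier G. len g \<ge> C"
  shows "\<exists>\<xi>\<in>Gromov_boundary x0. \<forall>g\<in>carrier G. fixes_end g \<xi>"
proof (cases "\<exists>a\<in>carrier G. escaping a")
  case True
  then obtain a where a: "a \<in> carrier G" "escaping a" by blast
  have "endpoint (\<lambda>i::nat. a [^] i) \<in> Gromov_boundary x0"
    "endpoint (\<lambda>i::nat. inv a [^] i) \<in> Gromov_boundary x0"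
    using escaping_conv a escaping_inv by (auto intro!: endpoint_in_boundary)
  then show ?thesis
    using fixes_one_of_two_ends[OF fixes_end_of_escaping[OF sd a]] by blast
next
  case False
  then show ?thesis using fixed_end_if_no_escaping unb by blast
qed

text \<open>Both \<open>u\<close> and \<open>u a\<close> turn back at their midpoints and start along nearly the same path, so they also
  come from nearly the same direction.\<close>

lemma gp_inv_mult_lower:
  assumes u: "u \<in> carrier G" "\<not> escaping u" and a: "a \<in> carrier G" "\<not> escaping (u \<otimes> a)"
  shows "gp (inv u) (inv a \<otimes> inv u) \<ge> len u / 2 - len a - 3 * \<delta>"
proof -
  have 1: "gp (inv u) u \<ge> len u / 2 - \<delta>"
    by (rule gp_inv_if_not_escaping[OF u])
  have 2: "gp u (u \<otimes> a) \<ge> len u - len a"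
    using gp_mult_right[OF u(1) a(1)] gp_le_len[of a "inv u"] by (simp add: gp_commute)
  have "gp (inv (u \<otimes> a)) (u \<otimes> a) \<ge> len (u \<otimes> a) / 2 - \<delta>"
    using u a by (intro gp_inv_if_not_escaping) auto
  then have 3: "gp (u \<otimes> a) (inv a \<otimes> inv u) \<ge> len u / 2 - len a / 2 - \<delta>"
    using len_mult_lower(1)[OF u(1) a(1)] u(1) a(1) by (simp add: inv_mult_group gp_commute)
  show ?thesis
    using gp_hyp[of "inv u" u "inv a \<otimes> inv u"] gp_hyp[of u "u \<otimes> a" "inv a \<otimes> inv u"] 1 2 3
      len_nonneg[of a] len_nonneg[of u] delta_nonneg
    by linarith
qed

lemma shared_directions_if_not_escaping:
  assumes "\<And>a b R. a \<in> carrier G \<Longrightarrow> b \<in> carrier G \<Longrightarrow>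
    \<exists>u\<in>carrier G. len u \<ge> R \<and> \<not> escaping u \<and> \<not> escaping (u \<otimes> a) \<and> \<not> escaping (u \<otimes> b)"
  shows shared_directions
  unfolding shared_directions_def
proof (intro ballI allI)
  fix c d R assume c: "c \<in> carrier G" and d: "d \<in> carrier G"
  obtain u where u: "u \<in> carrier G" "len u \<ge> 2 * (R + len c + len d + 3 * \<delta>)"
    "\<not> escaping u" "\<not> escaping (u \<otimes> inv c)" "\<not> escaping (u \<otimes> inv d)"
    using assms[of "inv c" "inv d"] c d by blast
  have "gp (inv u) (c \<otimes> inv u) \<ge> R" "gp (inv u) (d \<otimes> inv u) \<ge> R"
    using gp_inv_mult_lower[OF u(1,3) _ u(4)] gp_inv_mult_lower[OF u(1,3) _ u(5)] c d u(2)
      len_nonneg[of c] len_nonneg[of d] by simp_all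
  then show "\<exists>y\<in>carrier G. gp y (c \<otimes> y) \<ge> R \<and> gp y (d \<otimes> y) \<ge> R" using u(1) by blast
qed

lemma cyclic_product_len_bounded:
  assumes "\<And>h. h \<in> set hs \<Longrightarrow> h \<in> carrier G \<and> elliptic h"
  shows "\<exists>C. \<forall>f\<in>cyclic_product G hs. f \<in> carrier G \<and> len f \<le> C"
  using assms
proof (induction hs)
  case Nil
  then show ?case by (auto simp: cyclic_product_def list_mult_def)
next
  case (Cons h hs)
  obtain C where C: "\<forall>f\<in>cyclic_product G hs. f \<in> carrier G \<and> len f \<le> C"
    using Cons.IH Cons.prems by auto
  obtain D where D: "\<And>n::int. len (h [^] n) \<le> D" using Cons.prems unfolding elliptic_def by auto
  have h: "h \<in> carrier G" using Cons.prems by simp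
  have "f \<in> carrier G \<and> len f \<le> D + C" if f: "f \<in> cyclic_product G (h # hs)" for f
  proof -
    obtain ns :: "int list" where ns: "length ns = length (h # hs)"
      "f = list_mult G (map2 (\<lambda>h n. h [^] n) (h # hs) ns)"
      using f unfolding cyclic_product_def by blast
    obtain n ms where n: "ns = n # ms" using ns(1) by (cases ns) auto
    define f' where "f' = list_mult G (map2 (\<lambda>h n. h [^] n) hs ms)"
    have "f' \<in> cyclic_product G hs"
      unfolding cyclic_product_def f'_def using ns(1) n by auto
    moreover have "f = h [^] n \<otimes> f'" using ns(2) n by (simp add: f'_def list_mult_def)
    ultimately show ?thesis using C D[of n] h len_mult[of "h [^] n" f'] by force
  qed
  then show ?case by blast
qed

lemma bounded_orbits_if_bounded_on_generators:
  assumes A: "A \<subseteq> carrier G" "boundedly_generated_by G A" and K: "\<And>k. k \<in> A \<Longrightarrow> len k \<le> K"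
  shows "bounded (orbit G \<phi> x)"
proof -
  obtain n :: nat where n: "\<And>g. g \<in> carrier G \<Longrightarrow> \<exists>xs. length xs \<le> n \<and> set xs \<subseteq> A \<and> g = list_mult G xs"
    using A(2) unfolding boundedly_generated_by_def by blast
  have list: "list_mult G xs \<in> carrier G \<and> len (list_mult G xs) \<le> real (length xs) * \<bar>K\<bar>"
    if "set xs \<subseteq> A" for xs
    using that
  proof (induction xs)
    case Nil
    then show ?case by (simp add: list_mult_def)
  next
    case (Cons y ys)
    then have "y \<in> carrier G" "len y \<le> \<bar>K\<bar>" using A(1) K[of y] by auto
    moreover have "list_mult G (y # ys) = y \<otimes> list_mult G ys" by (simp add: list_mult_def)
    ultimately show ?case using Cons len_mult[of y "list_mult G ys"] by (auto simp: algebra_simps)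
  qed
  have len: "len g \<le> real n * \<bar>K\<bar>" if g: "g \<in> carrier G" for g
  proof -
    obtain xs where xs: "length xs \<le> n" "set xs \<subseteq> A" "g = list_mult G xs" using n[OF g] by blast
    have "real (length xs) * \<bar>K\<bar> \<le> real n * \<bar>K\<bar>" using xs(1) by (intro mult_right_mono) auto
    then show ?thesis using list[OF xs(2)] xs(3) by simp
  qed
  have "dist x0 (\<phi> g x) \<le> real n * \<bar>K\<bar> + dist x0 x" if "g \<in> carrier G" for g
    using dist_triangle[of x0 "\<phi> g x" "\<phi> g x0"] len[OF that] dist_action[OF that, of x0 x]
    unfolding len_def by linarith
  then show ?thesis unfolding bounded_def orbit_def by blast
qed

end


section \<open>The fixed point theorem\<close>

theorem theorem1p1:
  fixes G :: "('a, 'c) monoid_scheme" (structure)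
    and A B :: "'a set"
    and \<phi> :: "'a \<Rightarrow> 'x::metric_space \<Rightarrow> 'x"
    and x0 :: 'x
  assumes "group G"
    and "A \<subseteq> B" and "B \<subseteq> carrier G"
    and "boundedly_generated_by G A"
    and "\<forall>a\<in>B. \<forall>b\<in>B. \<exists>g\<in>carrier G. \<exists>h\<in>carrier G.
           commutator G (g \<otimes> a \<otimes> inv g) a = \<one> \<and>
           commutator G (g \<otimes> a \<otimes> inv g) (h \<otimes> g \<otimes> a \<otimes> inv g \<otimes> inv h) = \<one> \<and>
           commutator G (h \<otimes> g \<otimes> a \<otimes> inv g \<otimes> inv h) b = \<one>"
    and "\<forall>a\<in>carrier G. \<forall>b\<in>carrier G. \<exists>h\<in>B. \<exists>hs. set hs \<subseteq> B \<and>
           (\<forall>k\<in>A. \<exists>f\<in>cyclic_product G hs.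
              f \<otimes> k \<otimes> inv f \<otimes> h \<in> B \<and>
              f \<otimes> k \<otimes> inv f \<otimes> h \<otimes> a \<in> B \<and>
              f \<otimes> k \<otimes> inv f \<otimes> h \<otimes> b \<in> B)"
    and "Gromov_hyperbolic (UNIV :: 'x set)"
    and "isometric_action G \<phi>"
  shows "(\<exists>\<xi>\<in>Gromov_boundary x0. \<forall>g\<in>carrier G. boundary_map (\<phi> g) \<xi> = \<xi>) \<or>
         (\<exists>\<xi>\<in>Gromov_boundary x0. \<exists>\<eta>\<in>Gromov_boundary x0. \<xi> \<noteq> \<eta> \<and>
            (\<forall>g\<in>carrier G. boundary_map (\<phi> g) ` {\<xi>, \<eta>} = {\<xi>, \<eta>})) \<or>
         (\<forall>x. bounded (orbit G \<phi> x))"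
proof -
  obtain \<delta> where \<delta>: "\<delta> \<ge> 0" "delta_hyperbolic \<delta> (UNIV :: 'x set)"
    using assms(7) unfolding Gromov_hyperbolic_def by blast
  interpret hyperbolic_isometric_action G \<phi> x0 \<delta>
    using assms(1,8) \<delta> by (simp add: hyperbolic_isometric_action_def hyperbolic_isometric_action_axioms_def)
  have AB: "A \<subseteq> carrier G" using assms(2,3) by blast
  consider (nonelliptic) a where "a \<in> B" "\<not> elliptic a"
    | (bounded) K where "\<And>k. k \<in> A \<Longrightarrow> len k \<le> K"
    | (elliptic) "\<forall>b\<in>B. elliptic b" "\<forall>R. \<exists>k\<in>A. len k > R"
    by (meson not_less)
  then show ?thesis
  proof cases
    case nonelliptic
    have a: "a \<in> carrier G" using nonelliptic assms(3) by blast
    obtain N :: "nat \<Rightarrow> int" where N: "conv (\<lambda>i. a [^] N i)" "conv (\<lambda>i. inv (a [^] N i))"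
      using nonelliptic_conv[OF a nonelliptic(2)] .
    let ?\<xi> = "endpoint (\<lambda>i. a [^] N i)"
    have gen: "fixes_end b ?\<xi>" if "b \<in> A" for b
    proof -
      have b: "b \<in> B" "b \<in> carrier G" using that assms(2,3) by blast+
      obtain g h where gh: "g \<in> carrier G" "h \<in> carrier G"
        "commutator G (g \<otimes> a \<otimes> inv g) a = \<one>"
        "commutator G (g \<otimes> a \<otimes> inv g) (h \<otimes> g \<otimes> a \<otimes> inv g \<otimes> inv h) = \<one>"
        "commutator G (h \<otimes> g \<otimes> a \<otimes> inv g \<otimes> inv h) b = \<one>"
        using bspec[OF bspec[OF assms(5) nonelliptic(1)] b(1)] by blast
      have car: "g \<otimes> a \<otimes> inv g \<in> carrier G" "h \<otimes> g \<otimes> a \<otimes> inv g \<otimes> inv h \<in> carrier G"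
        using a gh(1,2) by simp_all
      have conj: "h \<otimes> g \<otimes> a \<otimes> inv g \<otimes> inv h = h \<otimes> (g \<otimes> a \<otimes> inv g) \<otimes> inv h"
        using a gh(1,2) by (simp add: m_assoc)
      note comm = commute_if_commutator_eq_one[OF car(1) a gh(3)]
        commute_if_commutator_eq_one[OF car gh(4)] commute_if_commutator_eq_one[OF car(2) b(2) gh(5)]
      show ?thesis
        by (rule commuting_chain_fixes_endpoint[OF a b(2) gh(1,2) N refl comm(1) conj comm(2,3)])
    qed
    have "\<forall>g\<in>carrier G. fixes_end g ?\<xi>"
      by (intro ballI generators_fix_end[OF AB assms(4) gen])
    then show ?thesis by (intro disjI1 bexI[OF _ endpoint_in_boundary[OF N(1)]])
  next
    case bounded
    then have "bounded (orbit G \<phi> x)" for x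
      by (rule bounded_orbits_if_bounded_on_generators[OF AB assms(4)])
    then show ?thesis by simp
  next
    case elliptic
    have B: "b \<in> carrier G" "\<not> escaping b" if "b \<in> B" for b
    proof -
      show "b \<in> carrier G" using that assms(3) by blast
      then show "\<not> escaping b" using elliptic(1) that by (intro elliptic_not_escaping) auto
    qed
    have shared_directions
    proof (rule shared_directions_if_not_escaping)
      fix a b R assume a: "a \<in> carrier G" and b: "b \<in> carrier G"
      obtain h hs where h: "h \<in> B" "set hs \<subseteq> B"
        and ex_f: "\<forall>k\<in>A. \<exists>f\<in>cyclic_product G hs. f \<otimes> k \<otimes> inv f \<otimes> h \<in> B \<and>
              f \<otimes> k \<otimes> inv f \<otimes> h \<otimes> a \<in> B \<and> f \<otimes> k \<otimes> inv f \<otimes> h \<otimes> b \<in> B"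
        using bspec[OF bspec[OF assms(6) a] b] by (elim bexE exE conjE)
      obtain C where C: "\<forall>f\<in>cyclic_product G hs. f \<in> carrier G \<and> len f \<le> C"
        using cyclic_product_len_bounded[of hs] h(2) B(1) elliptic(1) by (meson subsetD)
      \<comment> \<open>Conjugating by \<open>f\<close> and multiplying by \<open>h\<close> costs a bounded amount of length.\<close>
      obtain k where k: "k \<in> A" "len k > R + 2 * C + len h" using elliptic(2) by blast
      obtain f where f: "f \<in> cyclic_product G hs" "f \<otimes> k \<otimes> inv f \<otimes> h \<in> B"
          "f \<otimes> k \<otimes> inv f \<otimes> h \<otimes> a \<in> B" "f \<otimes> k \<otimes> inv f \<otimes> h \<otimes> b \<in> B"
        using bspec[OF ex_f k(1)] by (elim bexE conjE)
      have car: "f \<in> carrier G" "k \<in> carrier G" "h \<in> carrier G" and fC: "len f \<le> C"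
        using bspec[OF C f(1)] subsetD[OF AB k(1)] B(1)[OF h(1)] by simp_all
      have "len (f \<otimes> k \<otimes> inv f \<otimes> h) \<ge> R"
        using len_mult_lower(1)[of "f \<otimes> k \<otimes> inv f" h] len_mult_lower(1)[of "f \<otimes> k" "inv f"]
          len_mult_lower(2)[of f k] car fC k(2)
        by simp
      then show "\<exists>u\<in>carrier G. len u \<ge> R \<and> \<not> escaping u \<and> \<not> escaping (u \<otimes> a) \<and> \<not> escaping (u \<otimes> b)"
        using B(1)[OF f(2)] B(2)[OF f(2)] B(2)[OF f(3)] B(2)[OF f(4)] by (intro bexI conjI)
    qed
    moreover have "\<exists>g\<in>carrier G. len g \<ge> C" for C
      using elliptic(2) AB by (meson less_imp_le subsetD)
    ultimately show ?thesis by (intro disjI1 fixed_end_if_shared_directions)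
  qed
qed

end
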